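(* Let $q$ be a prime power with $q\equiv 3\pmod 4$. The hypergraph $\mathcal{H}_{T^*(q)}$ is isomorphic to $\mathcal{H}_q$ (via the map sending $[x:1]\mapsto (x,1)$ for $x\in\mathbb{F}_q$ and $[1:0]\mapsto(1,0)$).
   Context: $\mathbb{P}^1\mathbb{F}_q$ is the projective line over $\mathbb{F}_q$, i.e. the set of classes $[u_1:u_2]$ of nonzero vectors of $\mathbb{F}_q^2$ modulo nonzero scalars. For $u=(u_1,u_2),v=(v_1,v_2)\in\mathbb{F}_q^2$ let $D(u,v)=u_1v_2-u_2v_1$. Let $\chi$ be the quadratic character of $\mathbb{F}_q$ ($\chi(0)=0$, $\chi(x)=1$ for nonzero squares, $\chi(x)=-1$ otherwise). Define $S(a,b,c,d)=\chi\big(D(a,b)D(b,c)D(c,d)D(a,d)\big)$, which is well defined on $(\mathbb{P}^1\mathbb{F}_q)^4$. The hypergraph $\mathcal{H}_q$ has vertex set $\mathbb{P}^1\mathbb{F}_q$, and a set $\{a,b,c,d\}$ of four distinct points is a hyperedge iff $S(\pi(a),\pi(b),\pi(c),\pi(d))=-1$ for every permutation $\pi$ of $\{a,b,c,d\}$. The tournament $T^*(q)$ has vertex set $\{(x,1): x\in\mathbb{F}_q\}\cup\{(1,0)\}$, and for distinct vertices $\alpha,\beta$ the edge is directed $\alpha\to\beta$ iff $D(\beta,\alpha)$ is a square in $\mathbb{F}_q$ (so on $\{(x,1)\}$ it is the Paley tournament and all edges at $(1,0)$ point towards $(1,0)$). For a tournament $T$ on vertex set $V$, $\mathcal{H}_T$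 is the $4$-uniform hypergraph on $V$ whose hyperedges are the $4$-sets $\{a,b,c,d\}$ which can be labelled so that $a\to b$, $b\to c$, $c\to a$ in $T$, and the three edges between $d$ and $a,b,c$ are either all directed towards $d$ or all directed away from $d$.
   Formalization: The last factor D(a,d) in the definition of S is replaced by D(d,a); with D(a,d) as printed, S cannot be -1 for all permutations, so H_q would have no hyperedges while H_{T*(q)} has some, and the claim would be false. *)

theory Defs
  imports
    "HOL-Computational_Algebra.Nth_Powers"
    "HOL-Number_Theory.Prime_Powers"
    "HOL-Combinatorics.Permutations"
    "Graph_Theory.Pair_Digraph"
begin

section \<open>The projective line\<close>

text \<open>A partial equivalence relation: its domain consists of the nonzero vectors.\<close>

definition proj_rel :: "'a::field \<times> 'a \<Rightarrow> 'a \<times> 'a \<Rightarrow> bool" where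
  "proj_rel u v \<longleftrightarrow> u \<noteq> (0, 0) \<and> v \<noteq> (0, 0) \<and>
     (\<exists>k. k \<noteq> 0 \<and> v = (k * fst u, k * snd u))"

lemma part_equivp_proj_rel: "part_equivp (proj_rel :: 'a::field \<times> 'a \<Rightarrow> _)"
proof (rule part_equivpI)
  have "proj_rel (1 :: 'a, 0 :: 'a) (1, 0)"
    by (auto simp: proj_rel_def intro!: exI[of _ 1])
  then show "\<exists>u :: 'a \<times> 'a. proj_rel u u" ..
  show "symp (proj_rel :: 'a \<times> 'a \<Rightarrow> _)"
  proof (rule sympI)
    fix u v :: "'a \<times> 'a"
    assume "proj_rel u v"
    then obtain k where k: "u \<noteq> (0, 0)" "v \<noteq> (0, 0)" "k \<noteq> 0"
        "v = (k * fst u, k * snd u)"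
      unfolding proj_rel_def by blast
    have "inverse k * (k * x) = x" for x
      using k(3) by (simp flip: mult.assoc)
    then have "u = (inverse k * fst v, inverse k * snd v)"
      unfolding k(4) by (simp only: fst_conv snd_conv prod.collapse)
    moreover have "inverse k \<noteq> 0"
      using k(3) by simp
    ultimately show "proj_rel v u"
      using k(1,2) unfolding proj_rel_def by blast
  qed
  show "transp (proj_rel :: 'a \<times> 'a \<Rightarrow> _)"
  proof (rule transpI)
    fix u v w :: "'a \<times> 'a"
    assume "proj_rel u v" "proj_rel v w"
    then obtain k l where kl: "u \<noteq> (0, 0)" "w \<noteq> (0, 0)" "k \<noteq> 0" "l \<noteq> 0"
        "v = (k * fst u, k * snd u)" "w = (l * fst v, l * snd v)"
      unfolding proj_rel_def by blast
    have "w = (l * k * fst u, l * k * snd u)"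
      unfolding kl(6) unfolding kl(5) by (simp add: mult.assoc)
    moreover have "l * k \<noteq> 0"
      using kl(3,4) by simp
    ultimately show "proj_rel u w"
      using kl(1,2) unfolding proj_rel_def by blast
  qed
qed

quotient_type (overloaded) 'a proj_line = "'a::field \<times> 'a" / partial: proj_rel
  by (rule part_equivp_proj_rel)

text \<open>The point $[x:y]$; unspecified for $x = y = 0$.\<close>

definition proj_pt :: "'a::field \<Rightarrow> 'a \<Rightarrow> 'a proj_line" where
  "proj_pt x y = abs_proj_line (x, y)"

definition D :: "'a::field \<times> 'a \<Rightarrow> 'a \<times> 'a \<Rightarrow> 'a" where
  "D u v = fst u * snd v - snd u * fst v"

definition quad_char :: "'a::field \<Rightarrow> int" where
  "quad_char x = (if x = 0 then 0 else if is_square x then 1 else - 1)"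

lemma is_square_square_mult_iff:
  fixes k x :: "'a::field"
  assumes "k \<noteq> 0"
  shows "is_square (k ^ 2 * x) \<longleftrightarrow> is_square x"
proof
  assume "is_square (k ^ 2 * x)"
  then obtain y where "k ^ 2 * x = y ^ 2"
    by (auto elim: is_nth_powerE)
  with assms have "x = (y / k) ^ 2"
    by (simp add: field_simps)
  then show "is_square x" by (auto intro: is_nth_powerI)
next
  assume "is_square x"
  then obtain y where "x = y ^ 2" by (auto elim: is_nth_powerE)
  then have "k ^ 2 * x = (k * y) ^ 2" by (simp add: power_mult_distrib)
  then show "is_square (k ^ 2 * x)" by (metis is_nth_powerI)
qed

text \<open>
  The product runs cyclically, with last factor \<open>D d a\<close> and not \<open>D a d\<close>. With
  \<open>D a d\<close> the three values at \<open>(a, b, c, d)\<close>, \<open>(a, c, b, d)\<close>, \<open>(b, a, c, d)\<close> would multiply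
  to \<open>1\<close> for distinct points over a finite field, so they could never all be \<open>- 1\<close> and \<open>hypergraph_Hq\<close> below
  would have no hyperedges. If \<open>- 1\<close> is not a square, as for fields of order \<open>3\<close> modulo
  \<open>4\<close>, the two versions differ by the sign of \<open>S\<close>.
\<close>

lift_definition S ::
  "'a::field proj_line \<Rightarrow> 'a proj_line \<Rightarrow> 'a proj_line \<Rightarrow> 'a proj_line \<Rightarrow> int"
  is "\<lambda>a b c d. quad_char (D a b * D b c * D c d * D d a)"
proof -
  fix a a' b b' c c' d d' :: "'a \<times> 'a"
  assume r: "proj_rel a a'" "proj_rel b b'" "proj_rel c c'" "proj_rel d d'"
  obtain k where k: "k \<noteq> 0" "a' = (k * fst a, k * snd a)"
    using r(1) unfolding proj_rel_def by blast
  obtain l where l: "l \<noteq> 0" "b' = (l * fst b, l * snd b)"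
    using r(2) unfolding proj_rel_def by blast
  obtain m where m: "m \<noteq> 0" "c' = (m * fst c, m * snd c)"
    using r(3) unfolding proj_rel_def by blast
  obtain n where n: "n \<noteq> 0" "d' = (n * fst d, n * snd d)"
    using r(4) unfolding proj_rel_def by blast
  have D_scale: "D (s * fst u, s * snd u) (t * fst v, t * snd v) = s * t * D u v"
    for s t :: 'a and u v
    by (simp add: D_def algebra_simps)
  have ac: "(k * l * w) * (l * m * x) * (m * n * y) * (n * k * z) =
      (k * l * m * n) ^ 2 * (w * x * y * z)" for w x y z
    by (simp add: power2_eq_square mult_ac)
  have "D a' b' * D b' c' * D c' d' * D d' a' =
      (k * l * m * n) ^ 2 * (D a b * D b c * D c d * D d a)"
    unfolding k(2) l(2) m(2) n(2) D_scale by (rule ac)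
  moreover have "k * l * m * n \<noteq> 0"
    using k(1) l(1) m(1) n(1) by simp
  ultimately show "quad_char (D a b * D b c * D c d * D d a) =
      quad_char (D a' b' * D b' c' * D c' d' * D d' a')"
    by (simp only: quad_char_def is_square_square_mult_iff mult_eq_0_iff[of "_ ^ 2"]
        power_eq_0_iff simp_thms)
qed

section \<open>Hypergraphs\<close>

text \<open>A hypergraph is a vertex set together with a set of hyperedges.\<close>

type_synonym 'v hypergraph = "'v set \<times> 'v set set"

definition hypergraph_iso :: "('v \<Rightarrow> 'w) \<Rightarrow> 'v hypergraph \<Rightarrow> 'w hypergraph \<Rightarrow> bool" where
  "hypergraph_iso f G H \<longleftrightarrow> bij_betw f (fst G) (fst H) \<and>
     (\<forall>e. e \<subseteq> fst G \<longrightarrow> (e \<in> snd G \<longleftrightarrow> f ` e \<in> snd H))"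

definition hypergraph_Hq :: "'a::field proj_line hypergraph" where
  "hypergraph_Hq = (UNIV,
     {{a, b, c, d} | a b c d. distinct [a, b, c, d] \<and>
        (\<forall>\<pi>. \<pi> permutes {a, b, c, d} \<longrightarrow> S (\<pi> a) (\<pi> b) (\<pi> c) (\<pi> d) = - 1)})"

text \<open>
  An arc \<open>(\<alpha>, \<beta>)\<close> means \<open>\<alpha> \<rightarrow> \<beta>\<close>. The digraph below is a tournament when \<open>'a\<close> is finite
  with \<open>CARD('a) mod 4 = 3\<close>.
\<close>

definition Tstar_verts :: "('a::field \<times> 'a) set" where
  "Tstar_verts = {(x, 1) | x. True} \<union> {(1, 0)}"

definition Tstar :: "('a::field \<times> 'a) pair_pre_digraph" where
  "Tstar = \<lparr> pverts = Tstar_verts,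
     parcs = {(\<alpha>, \<beta>). \<alpha> \<in> Tstar_verts \<and> \<beta> \<in> Tstar_verts \<and> \<alpha> \<noteq> \<beta> \<and> is_square (D \<beta> \<alpha>)} \<rparr>"

definition tournament_hypergraph :: "'v pair_pre_digraph \<Rightarrow> 'v hypergraph" where
  "tournament_hypergraph T = (pverts T,
     {{a, b, c, d} | a b c d. {a, b, c, d} \<subseteq> pverts T \<and> distinct [a, b, c, d] \<and>
        (a, b) \<in> parcs T \<and> (b, c) \<in> parcs T \<and> (c, a) \<in> parcs T \<and>
        ((\<forall>x\<in>{a, b, c}. (x, d) \<in> parcs T) \<or> (\<forall>x\<in>{a, b, c}. (d, x) \<in> parcs T))})"

end

(*
  If q = 3 mod 4, then -1 is a nonsquare, so on the representatives (x, 1), (1, 0) the sign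
  s(u, v) = chi(D(u, v)) is skew-symmetric and encodes the tournament: u -> v iff s(u, v) = -1.
  S is the product of the four signs around a 4-cycle. Among four points there are three
  4-cycles, and all three products are -1 exactly when the induced tournament is a cyclic
  triangle together with a source or a sink; this is a check of the 64 sign patterns.
*)

theory Submission
  imports Defs "HOL-Library.Cardinality" "HOL-Number_Theory.Residues"
begin

section \<open>The quadratic character\<close>

text \<open>Multiplication by \<open>x\<close> permutes the nonzero elements, so their nonzero
  product is unchanged when every factor is multiplied by \<open>x\<close>.\<close>

lemma finite_field_power_card_minus_one:
  fixes x :: "'a::{field, finite}"
  assumes "x \<noteq> 0"
  shows "x ^ (CARD('a) - 1) = 1"
proof -
  have "(\<Prod>y\<in>UNIV - {0}. x * y) = \<Prod>(UNIV - {0})"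
    by (rule prod.reindex_bij_witness[of _ "\<lambda>y. y / x" "(*) x"]) (use assms in auto)
  then have "x ^ card (UNIV - {0 :: 'a}) * \<Prod>(UNIV - {0}) = 1 * \<Prod>(UNIV - {0})"
    by (simp add: prod.distrib)
  moreover have "\<Prod>(UNIV - {0 :: 'a}) \<noteq> 0"
    by simp
  ultimately have "x ^ card (UNIV - {0 :: 'a}) = 1"
    by (metis mult_right_cancel)
  then show ?thesis
    by (simp add: card_Diff_singleton)
qed

text \<open>The characteristic divides the order of the field, so \<open>2 = 0\<close> would turn
  \<open>2 * m + 1 = 0\<close> into \<open>1 = 0\<close>.\<close>

lemma odd_card_one_neq_minus_one:
  assumes "odd CARD('a)"
  shows "(1 :: 'a::{field, finite}) \<noteq> - 1"
proof
  obtain m where m: "CARD('a) = 2 * m + 1"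
    using assms oddE by blast
  assume "(1 :: 'a) = - 1"
  then have two: "(2 :: 'a) = 0"
    by (metis add.right_inverse one_add_one)
  have "of_nat CARD('a) = (0 :: 'a)"
    using CHAR_dvd_CARD[where 'a = 'a] by (simp add: of_nat_eq_0_iff_char_dvd)
  then show False
    unfolding m by (simp add: two)
qed

text \<open>
  With \<open>CARD('a) = 2 * n + 1\<close> and \<open>n\<close> odd, \<open>x ^ n = \<plusminus> 1\<close>, so the square \<open>x ^ (n + 1)\<close>
  equals \<open>\<plusminus> x\<close>.
\<close>

lemma is_square_uminus_iff:
  fixes x :: "'a::{field, finite}"
  assumes card: "CARD('a) mod 4 = 3" and "x \<noteq> 0"
  shows "is_square (- x) \<longleftrightarrow> \<not> is_square x"
proof -
  define k where "k = CARD('a) div 4"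
  have k: "CARD('a) - 1 = 2 * (2 * k + 1)"
    using card unfolding k_def by presburger
  have "odd CARD('a)"
    using card by presburger
  then have neq: "(1 :: 'a) \<noteq> - 1"
    by (rule odd_card_one_neq_minus_one)
  have pow: "y ^ (2 * (2 * k + 1)) = 1" if "y \<noteq> 0" for y :: 'a
    using finite_field_power_card_minus_one[OF that] unfolding k .
  have square: "y ^ (2 * k + 1) = 1" if "is_square y" "y \<noteq> 0" for y :: 'a
  proof -
    obtain z where z: "y = z ^ 2"
      using \<open>is_square y\<close> by (rule is_nth_powerE)
    with that(2) have "z \<noteq> 0" by auto
    then show ?thesis
      using pow[of z] unfolding z power_mult[symmetric] by simp
  qed
  have sq: "x * x ^ (2 * k + 1) = (x ^ (k + 1)) ^ 2"
    by (simp add: mult.commute flip: power_mult power_Suc)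
  have "(x ^ (2 * k + 1)) ^ 2 = 1"
    using pow[OF assms(2)] by (simp only: power_mult[symmetric] mult.commute)
  then consider "x ^ (2 * k + 1) = 1" | "x ^ (2 * k + 1) = - 1"
    by (auto simp only: power2_eq_1_iff)
  then have "is_square x \<or> is_square (- x)"
  proof cases
    case 1
    with sq show ?thesis by (metis is_nth_powerI mult.right_neutral)
  next
    case 2
    with sq show ?thesis by (metis is_nth_powerI mult_minus1_right)
  qed
  \<comment> \<open>The exponent \<open>2 * k + 1\<close> sends nonzero squares to \<open>1\<close>;
    being odd, it preserves the sign in \<open>- x\<close>, so two squares \<open>x\<close> and
    \<open>- x\<close> would give \<open>1 = - 1\<close>.\<close>
  moreover have "\<not> (is_square x \<and> is_square (- x))"
  proof
    assume both: "is_square x \<and> is_square (- x)"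
    then have "x ^ (2 * k + 1) = 1" "(- x) ^ (2 * k + 1) = 1"
      using square[of x] square[of "- x"] assms(2) by simp_all
    moreover have "(- x) ^ (2 * k + 1) = - (x ^ (2 * k + 1))"
      by (rule power_minus_odd) simp
    ultimately show False
      using neq by simp
  qed
  ultimately show ?thesis by blast
qed

section \<open>Oddness and multiplicativity of the quadratic character\<close>

lemma quad_char_uminus:
  fixes x :: "'a::{field, finite}"
  assumes "CARD('a) mod 4 = 3"
  shows "quad_char (- x) = - quad_char x"
  using is_square_uminus_iff[OF assms, of x] by (simp add: quad_char_def)

lemma quad_char_mult:
  fixes x y :: "'a::{field, finite}"
  assumes "CARD('a) mod 4 = 3"
  shows "quad_char (x * y) = quad_char x * quad_char y"
proof -
  have square: "quad_char (u * v) = quad_char v" if "is_square u" "u \<noteq> 0" for u v :: 'a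
  proof -
    obtain z where z: "u = z ^ 2"
      using \<open>is_square u\<close> by (rule is_nth_powerE)
    with \<open>u \<noteq> 0\<close> have "z \<noteq> 0" by auto
    then show ?thesis
      by (simp add: z quad_char_def is_square_square_mult_iff)
  qed
  consider "x = 0" | "x \<noteq> 0" "is_square x" | "x \<noteq> 0" "\<not> is_square x" "is_square (- x)"
    using is_square_uminus_iff[OF assms, of x] by blast
  then show ?thesis
  proof cases
    case 1
    then show ?thesis by (simp add: quad_char_def)
  next
    case 2
    then show ?thesis using square[of x y] by (simp add: quad_char_def[of x])
  next
    case 3
    then show ?thesis
      using square[of "- x" y] quad_char_uminus[OF assms, of "x * y"]
      by (simp add: quad_char_def[of x])
  qed
qed

section \<open>Four-point subtournaments\<close>

text \<open>The combinatorial form of \<open>S\<close>, with the quadratic character of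
  \<open>D\<close> replaced by an arbitrary sign function.\<close>

definition cyc4 :: "('v \<Rightarrow> 'v \<Rightarrow> int) \<Rightarrow> 'v \<Rightarrow> 'v \<Rightarrow> 'v \<Rightarrow> 'v \<Rightarrow> int" where
  "cyc4 s a b c d = s a b * s b c * s c d * s d a"

text \<open>The labelling condition of \<open>tournament_hypergraph\<close> for an arbitrary
  relation, with apex \<open>d\<close>.\<close>

definition cone_triangle :: "('v \<Rightarrow> 'v \<Rightarrow> bool) \<Rightarrow> 'v \<Rightarrow> 'v \<Rightarrow> 'v \<Rightarrow> 'v \<Rightarrow> bool" where
  "cone_triangle E a b c d \<longleftrightarrow> E a b \<and> E b c \<and> E c a \<and>
     ((\<forall>x\<in>{a, b, c}. E x d) \<or> (\<forall>x\<in>{a, b, c}. E d x))"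

text \<open>
  The 24 cyclic products take only three values: for a skew-symmetric \<open>s\<close> the product is
  invariant under rotation and reflection of the 4-cycle.
\<close>

lemma cyc4_all_orderings:
  assumes skew: "\<And>x y. s y x = - s x y"
    and "cyc4 s a b c d = - 1" "cyc4 s a c b d = - 1" "cyc4 s b a c d = - 1"
    and "{w, x, y, z} \<subseteq> {a, b, c, d}" "distinct [w, x, y, z]"
  shows "cyc4 s w x y z = - 1"
proof -
  have rot: "cyc4 s x y z w = cyc4 s w x y z" for w x y z
    by (simp add: cyc4_def mult_ac)
  \<comment> \<open>Reversal flips all four factors, and the four signs cancel.\<close>
  have refl: "cyc4 s z y x w = cyc4 s w x y z" for w x y z
    by (simp add: cyc4_def mult_ac skew[of x w] skew[of y x] skew[of z y] skew[of w z])
  \<comment> \<open>Three dihedral orbits of eight orderings each, one for each hypothesis.\<close>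
  have 24: "cyc4 s a b c d = - 1" "cyc4 s b c d a = - 1" "cyc4 s c d a b = - 1"
    "cyc4 s d a b c = - 1" "cyc4 s d c b a = - 1" "cyc4 s c b a d = - 1"
    "cyc4 s b a d c = - 1" "cyc4 s a d c b = - 1"
    "cyc4 s a c b d = - 1" "cyc4 s c b d a = - 1" "cyc4 s b d a c = - 1"
    "cyc4 s d a c b = - 1" "cyc4 s d b c a = - 1" "cyc4 s b c a d = - 1"
    "cyc4 s c a d b = - 1" "cyc4 s a d b c = - 1"
    "cyc4 s b a c d = - 1" "cyc4 s a c d b = - 1" "cyc4 s c d b a = - 1"
    "cyc4 s d b a c = - 1" "cyc4 s d c a b = - 1" "cyc4 s c a b d = - 1"
    "cyc4 s a b d c = - 1" "cyc4 s b d c a = - 1"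
    using assms(2-4) by (metis rot refl)+
  have "w = a \<or> w = b \<or> w = c \<or> w = d" "x = a \<or> x = b \<or> x = c \<or> x = d"
    "y = a \<or> y = b \<or> y = c \<or> y = d" "z = a \<or> z = b \<or> z = c \<or> z = d"
    using assms(5) by simp_all
  then show ?thesis
    using assms(6) by (elim disjE; simp add: 24)
qed

text \<open>The product of the three values is always \<open>- 1\<close>, since skew symmetry enters
  for three edges. So they impose two independent conditions, leaving 16 of the 64 sign patterns:
  four choices of apex, source or sink, and two orientations of the triangle.\<close>

lemma cyc4_iff_cone_triangle:
  assumes skew: "\<And>x y. s y x = - s x y"
    and sgn: "\<And>x y. x \<in> A \<Longrightarrow> y \<in> A \<Longrightarrow> x \<noteq> y \<Longrightarrow> s x y = 1 \<or> s x y = - 1"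
    and A: "A = {a, b, c, d}" and dist: "distinct [a, b, c, d]"
    and E: "\<And>x y. x \<in> A \<Longrightarrow> y \<in> A \<Longrightarrow> x \<noteq> y \<Longrightarrow> E x y \<longleftrightarrow> s x y = - 1"
  shows "cyc4 s a b c d = - 1 \<and> cyc4 s a c b d = - 1 \<and> cyc4 s b a c d = - 1 \<longleftrightarrow>
    (\<exists>w x y z. A = {w, x, y, z} \<and> distinct [w, x, y, z] \<and> cone_triangle E w x y z)"
    (is "?L \<longleftrightarrow> ?R")
proof
  assume ?L
  have neq: "a \<noteq> b" "a \<noteq> c" "a \<noteq> d" "b \<noteq> c" "b \<noteq> d" "c \<noteq> d"
    using dist by auto
  have swap: "s b a = - s a b" "s c a = - s a c" "s d a = - s a d"
    "s c b = - s b c" "s d b = - s b d" "s d c = - s c d"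
    by (rule skew)+
  have signs: "s a b = 1 \<or> s a b = - 1" "s a c = 1 \<or> s a c = - 1" "s a d = 1 \<or> s a d = - 1"
    "s b c = 1 \<or> s b c = - 1" "s b d = 1 \<or> s b d = - 1" "s c d = 1 \<or> s c d = - 1"
    using neq unfolding A by (simp_all add: sgn[unfolded A])
  have arcs: "E a b \<longleftrightarrow> s a b = - 1" "E a c \<longleftrightarrow> s a c = - 1" "E a d \<longleftrightarrow> s a d = - 1"
    "E b c \<longleftrightarrow> s b c = - 1" "E b d \<longleftrightarrow> s b d = - 1" "E c d \<longleftrightarrow> s c d = - 1"
    "E b a \<longleftrightarrow> s a b = 1" "E c a \<longleftrightarrow> s a c = 1" "E d a \<longleftrightarrow> s a d = 1"
    "E c b \<longleftrightarrow> s b c = 1" "E d b \<longleftrightarrow> s b d = 1" "E d c \<longleftrightarrow> s c d = 1"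
    using neq by (simp_all add: E[unfolded A] swap)
  \<comment> \<open>One labelling for each apex and each cyclic orientation of the other three
    points.\<close>
  have cone: "cone_triangle E a b c d \<or> cone_triangle E a c b d \<or>
      cone_triangle E a b d c \<or> cone_triangle E a d b c \<or>
      cone_triangle E a c d b \<or> cone_triangle E a d c b \<or>
      cone_triangle E b c d a \<or> cone_triangle E b d c a"
    using signs \<open>?L\<close> unfolding cone_triangle_def cyc4_def arcs swap
    by (elim disjE; simp add: arcs)
  have "A = {a, b, c, d}" "A = {a, c, b, d}" "A = {a, b, d, c}" "A = {a, d, b, c}"
    "A = {a, c, d, b}" "A = {a, d, c, b}" "A = {b, c, d, a}" "A = {b, d, c, a}"
    unfolding A by auto
  moreover have "distinct [a, b, c, d]" "distinct [a, c, b, d]" "distinct [a, b, d, c]"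
    "distinct [a, d, b, c]" "distinct [a, c, d, b]" "distinct [a, d, c, b]"
    "distinct [b, c, d, a]" "distinct [b, d, c, a]"
    using neq by auto
  ultimately show ?R
    using cone by blast
next
  assume ?R
  then obtain w x y z where A': "A = {w, x, y, z}" and dist': "distinct [w, x, y, z]"
    and cone: "cone_triangle E w x y z"
    by blast
  have arcs: "s w x = - 1" "s x y = - 1" "s y w = - 1"
    using cone E dist' unfolding cone_triangle_def A' by auto
  have "s w z = - 1 \<and> s x z = - 1 \<and> s y z = - 1 \<or> s z w = - 1 \<and> s z x = - 1 \<and> s z y = - 1"
    using cone E dist' unfolding cone_triangle_def A' by auto
  \<comment> \<open>Each 4-cycle runs along two triangle edges in the same direction, with equal
    signs, and then into and out of the apex \<open>z\<close>, with opposite signs.\<close>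
  then have "cyc4 s w x y z = - 1" "cyc4 s w y x z = - 1" "cyc4 s x w y z = - 1"
    using arcs skew[of w x] skew[of x y] skew[of y w] skew[of z w] skew[of z x] skew[of z y]
    unfolding cyc4_def by auto
  \<comment> \<open>The cone labelling need not match \<open>a\<close>, \<open>b\<close>,
    \<open>c\<close>, \<open>d\<close>, so the three values are carried to every ordering of the
    same four points.\<close>
  note orderings = cyc4_all_orderings[of s, OF skew this]
  have "{a, b, c, d} \<subseteq> {w, x, y, z}"
    using A A' by simp
  then show ?L
    using dist by (intro conjI orderings) (simp_all add: eq_commute[of c b] eq_commute[of b a])
qed

text \<open>The identity and the transpositions of \<open>b\<close>, \<open>c\<close> and of
  \<open>a\<close>, \<open>b\<close> reach the three orderings; \<open>all\<close> spreads
  \<open>P\<close> from these to every permutation.\<close>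

lemma permutes_quadruple_iff:
  assumes "distinct [a, b, c, d]"
    and all: "\<And>w x y z. P a b c d \<Longrightarrow> P a c b d \<Longrightarrow> P b a c d \<Longrightarrow>
      {w, x, y, z} \<subseteq> {a, b, c, d} \<Longrightarrow> distinct [w, x, y, z] \<Longrightarrow> P w x y z"
  shows "(\<forall>\<pi>. \<pi> permutes {a, b, c, d} \<longrightarrow> P (\<pi> a) (\<pi> b) (\<pi> c) (\<pi> d)) \<longleftrightarrow>
    P a b c d \<and> P a c b d \<and> P b a c d" (is "?L \<longleftrightarrow> ?R")
proof
  assume L: ?L
  have "P a b c d"
    using L[rule_format, OF permutes_id] by simp
  moreover have "P a c b d"
    using L[rule_format, of "transpose b c"] assms(1)
    by (auto simp: permutes_swap_id transpose_apply_other)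
  moreover have "P b a c d"
    using L[rule_format, of "transpose a b"] assms(1)
    by (auto simp: permutes_swap_id transpose_apply_other)
  ultimately show ?R by blast
next
  assume R: ?R
  show ?L
  proof (intro allI impI)
    fix \<pi> assume perm: "\<pi> permutes {a, b, c, d}"
    have "distinct [\<pi> a, \<pi> b, \<pi> c, \<pi> d]"
      using assms(1) permutes_inj[OF perm] by (auto dest: injD)
    moreover have "{\<pi> a, \<pi> b, \<pi> c, \<pi> d} \<subseteq> {a, b, c, d}"
      using permutes_image[OF perm] by auto
    ultimately show "P (\<pi> a) (\<pi> b) (\<pi> c) (\<pi> d)"
      using R all by blast
  qed
qed

section \<open>The isomorphism\<close>

text \<open>Every class has exactly one normalised vector: second coordinate \<open>1\<close>, or
  \<open>(1, 0)\<close> at infinity.\<close>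

lemma abs_proj_line_Tstar_verts:
  "bij_betw abs_proj_line (Tstar_verts :: ('a::field \<times> 'a) set) UNIV"
proof (rule bij_betwI')
  fix u v :: "'a \<times> 'a"
  assume uv: "u \<in> Tstar_verts" "v \<in> Tstar_verts"
  then have refl: "proj_rel u u" "proj_rel v v"
    by (auto simp: Tstar_verts_def proj_rel_def intro!: exI[of _ 1])
  then have "abs_proj_line u = abs_proj_line v \<longleftrightarrow> proj_rel u v"
    using Quotient3_rel[OF Quotient3_proj_line, of u v] by blast
  also have "\<dots> \<longleftrightarrow> u = v"
  proof
    assume "proj_rel u v"
    then obtain k where "k \<noteq> 0" "v = (k * fst u, k * snd u)"
      unfolding proj_rel_def by blast
    with uv show "u = v"
      by (auto simp: Tstar_verts_def)
  qed (use refl in simp)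
  finally show "abs_proj_line u = abs_proj_line v \<longleftrightarrow> u = v" .
next
  fix p :: "'a proj_line"
  \<comment> \<open>In this partial quotient \<open>proj_rel u u\<close> says that \<open>u\<close>
    is nonzero, which is what makes \<open>x\<close> invertible when \<open>y = 0\<close>.\<close>
  obtain u where u: "proj_rel u u" "p = abs_proj_line u"
    using Quotient3_abs_rep[OF Quotient3_proj_line, of p]
      Quotient3_rep_reflp[OF Quotient3_proj_line, of p] by metis
  obtain x y where xy: "u = (x, y)" by fastforce
  define v :: "'a \<times> 'a" where "v = (if y = 0 then (1, 0) else (x / y, 1))"
  have "v \<in> Tstar_verts"
    by (auto simp: v_def Tstar_verts_def)
  moreover have "proj_rel u v"
  proof (cases "y = 0")
    case True
    then show ?thesis
      using u(1) unfolding xy v_def proj_rel_def by (auto intro!: exI[of _ "1 / x"])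
  next
    case False
    then show ?thesis
      unfolding xy v_def proj_rel_def by (auto intro!: exI[of _ "1 / y"])
  qed
  then have "p = abs_proj_line v"
    using Quotient3_rel[OF Quotient3_proj_line, of u v] unfolding u(2) by blast
  ultimately show "\<exists>v\<in>Tstar_verts. p = abs_proj_line v" by blast
qed simp

section \<open>The form \<open>D\<close> and the sign \<open>S\<close> on normalised vectors\<close>

lemma D_swap: "D v u = - D u v"
  by (simp add: D_def algebra_simps)

lemma D_Tstar_verts_eq_0_iff:
  assumes "u \<in> Tstar_verts" "v \<in> Tstar_verts"
  shows "D u v = 0 \<longleftrightarrow> u = v"
  using assms by (auto simp: Tstar_verts_def D_def)

text \<open>Multiplicativity splits \<open>S\<close> into four signs. Unlike \<open>S\<close>, a
  single sign depends on the representatives, so these are fixed in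
  \<open>Tstar_verts\<close>.\<close>

lemma S_abs_proj_line:
  fixes a b c d :: "'a::{field, finite} \<times> 'a"
  assumes "CARD('a) mod 4 = 3" and "{a, b, c, d} \<subseteq> Tstar_verts"
  shows "S (abs_proj_line a) (abs_proj_line b) (abs_proj_line c) (abs_proj_line d) =
    cyc4 (\<lambda>u v. quad_char (D u v)) a b c d"
proof -
  have "proj_rel u u" if "u \<in> Tstar_verts" for u :: "'a \<times> 'a"
    using that by (auto simp: Tstar_verts_def proj_rel_def intro!: exI[of _ 1])
  then show ?thesis
    using assms by (simp add: S.abs_eq cyc4_def quad_char_mult)
qed

text \<open>Both hyperedge conditions are expressed by the signs \<open>s\<close> on
  \<open>W\<close> and then compared through \<open>cyc4_iff_cone_triangle\<close>.\<close>

lemma hyperedge_Hq_iff: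
  fixes W :: "('a::{field, finite} \<times> 'a) set"
  assumes card: "CARD('a) mod 4 = 3" and W: "W \<subseteq> Tstar_verts"
  shows "abs_proj_line ` W \<in> snd hypergraph_Hq \<longleftrightarrow> W \<in> snd (tournament_hypergraph Tstar)"
proof -
  let ?g = "abs_proj_line :: 'a \<times> 'a \<Rightarrow> _"
  define s :: "'a \<times> 'a \<Rightarrow> 'a \<times> 'a \<Rightarrow> int" where "s = (\<lambda>u v. quad_char (D u v))"
  define E where "E u v \<longleftrightarrow> (u, v) \<in> parcs (Tstar :: ('a \<times> 'a) pair_pre_digraph)" for u v
  have skew: "s v u = - s u v" for u v
    unfolding s_def D_swap[of v u] quad_char_uminus[OF card] ..
  have sgn: "s u v = 1 \<or> s u v = - 1" if "u \<in> W" "v \<in> W" "u \<noteq> v" for u v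
    using that W D_Tstar_verts_eq_0_iff[of u v] by (auto simp: s_def quad_char_def)
  have arc: "E u v \<longleftrightarrow> s u v = - 1" if "u \<in> W" "v \<in> W" "u \<noteq> v" for u v
  proof -
    \<comment> \<open>Arcs test \<open>D\<close> with the endpoints reversed; skew symmetry then
      gives the value \<open>- 1\<close> for \<open>s u v\<close>.\<close>
    have "E u v \<longleftrightarrow> s v u = 1"
      using that W D_Tstar_verts_eq_0_iff[of v u]
      by (auto simp: E_def Tstar_def s_def quad_char_def)
    then show ?thesis
      by (simp add: skew[of u v])
  qed
  have inj: "inj_on ?g Tstar_verts"
    using abs_proj_line_Tstar_verts by (rule bij_betw_imp_inj_on)
  have tournament: "W \<in> snd (tournament_hypergraph Tstar) \<longleftrightarrow>
      (\<exists>a b c d. W = {a, b, c, d} \<and> distinct [a, b, c, d] \<and> cone_triangle E a b c d)"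
  proof -
    have verts: "W \<subseteq> pverts Tstar"
      using W by (simp add: Tstar_def)
    show ?thesis
      unfolding tournament_hypergraph_def snd_conv mem_Collect_eq cone_triangle_def E_def
      by (intro ex_cong1; rule conj_cong; use verts in simp)
  qed
  have Hq: "?g ` W \<in> snd hypergraph_Hq \<longleftrightarrow>
      (\<exists>a b c d. W = {a, b, c, d} \<and> distinct [a, b, c, d] \<and>
        (\<forall>\<pi>. \<pi> permutes {?g a, ?g b, ?g c, ?g d} \<longrightarrow>
          S (\<pi> (?g a)) (\<pi> (?g b)) (\<pi> (?g c)) (\<pi> (?g d)) = - 1))" (is "_ \<longleftrightarrow> ?R")
  proof
    assume "?g ` W \<in> snd hypergraph_Hq"
    then obtain p q r t where pqrt: "?g ` W = {p, q, r, t}" "distinct [p, q, r, t]"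
      "\<forall>\<pi>. \<pi> permutes {p, q, r, t} \<longrightarrow> S (\<pi> p) (\<pi> q) (\<pi> r) (\<pi> t) = - 1"
      unfolding hypergraph_Hq_def snd_conv mem_Collect_eq by blast
    from this(1) have "p \<in> ?g ` W" "q \<in> ?g ` W" "r \<in> ?g ` W" "t \<in> ?g ` W"
      by auto
    then obtain a b c d where abcd: "{a, b, c, d} \<subseteq> W"
      "p = ?g a" "q = ?g b" "r = ?g c" "t = ?g d"
      by blast
    then have "?g ` W = ?g ` {a, b, c, d}"
      using pqrt(1) by simp
    \<comment> \<open>Injectivity on the vertices turns equality of images into equality of
      sets.\<close>
    then have "W = {a, b, c, d}"
      using inj_on_image_eq_iff[OF inj W] abcd(1) W by blast
    moreover have "distinct [a, b, c, d]"
      using pqrt(2) abcd by auto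
    ultimately show ?R
      using pqrt(3) abcd(2-) by blast
  next
    assume ?R
    then obtain a b c d where abcd: "W = {a, b, c, d}" "distinct [a, b, c, d]"
      "\<forall>\<pi>. \<pi> permutes {?g a, ?g b, ?g c, ?g d} \<longrightarrow>
        S (\<pi> (?g a)) (\<pi> (?g b)) (\<pi> (?g c)) (\<pi> (?g d)) = - 1"
      by blast
    from this(1,2) have "distinct [?g a, ?g b, ?g c, ?g d]"
      using inj_on_subset[OF inj W] by (auto dest: inj_onD)
    with abcd show "?g ` W \<in> snd hypergraph_Hq"
      unfolding hypergraph_Hq_def snd_conv mem_Collect_eq
      by (intro exI[of _ "?g a"] exI[of _ "?g b"] exI[of _ "?g c"] exI[of _ "?g d"] conjI) simp_all
  qed
  have quadruple: "(\<forall>\<pi>. \<pi> permutes {?g a, ?g b, ?g c, ?g d} \<longrightarrow>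
        S (\<pi> (?g a)) (\<pi> (?g b)) (\<pi> (?g c)) (\<pi> (?g d)) = - 1) \<longleftrightarrow>
      cyc4 s a b c d = - 1 \<and> cyc4 s a c b d = - 1 \<and> cyc4 s b a c d = - 1"
    if eq: "W = {a, b, c, d}" and dist: "distinct [a, b, c, d]" for a b c d
  proof -
    have S_eq: "S (?g w) (?g x) (?g y) (?g z) = cyc4 s w x y z" if "{w, x, y, z} \<subseteq> W" for w x y z
      unfolding s_def using that W by (intro S_abs_proj_line card) auto
    have dist_g: "distinct [?g a, ?g b, ?g c, ?g d]"
      using inj_on_subset[OF inj W] dist eq by (auto dest: inj_onD)
    have "(\<forall>\<pi>. \<pi> permutes {?g a, ?g b, ?g c, ?g d} \<longrightarrow>
        S (\<pi> (?g a)) (\<pi> (?g b)) (\<pi> (?g c)) (\<pi> (?g d)) = - 1) \<longleftrightarrow>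
      S (?g a) (?g b) (?g c) (?g d) = - 1 \<and> S (?g a) (?g c) (?g b) (?g d) = - 1 \<and>
      S (?g b) (?g a) (?g c) (?g d) = - 1"
    proof (rule permutes_quadruple_iff[OF dist_g])
      fix p q r t
      assume three: "S (?g a) (?g b) (?g c) (?g d) = - 1" "S (?g a) (?g c) (?g b) (?g d) = - 1"
        "S (?g b) (?g a) (?g c) (?g d) = - 1"
        and sub: "{p, q, r, t} \<subseteq> {?g a, ?g b, ?g c, ?g d}" and dist': "distinct [p, q, r, t]"
      have "p \<in> ?g ` W" "q \<in> ?g ` W" "r \<in> ?g ` W" "t \<in> ?g ` W"
        using sub eq by auto
      then obtain w x y z where wxyz: "{w, x, y, z} \<subseteq> W"
        "p = ?g w" "q = ?g x" "r = ?g y" "t = ?g z"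
        by blast
      have "cyc4 s w x y z = - 1"
      proof (rule cyc4_all_orderings[OF skew])
        show "cyc4 s a b c d = - 1" "cyc4 s a c b d = - 1" "cyc4 s b a c d = - 1"
          using three by (simp_all add: S_eq eq)
        show "distinct [w, x, y, z]"
          using dist' wxyz by auto
      qed (use wxyz eq in simp)
      then show "S p q r t = - 1"
        using wxyz by (simp add: S_eq)
    qed
    then show ?thesis
      by (simp add: S_eq eq)
  qed
  \<comment> \<open>The right-hand side does not mention the labelling, so the permutation condition
    holds for one labelling of \<open>W\<close> iff it holds for all.\<close>
  have cone: "(\<forall>\<pi>. \<pi> permutes {?g a, ?g b, ?g c, ?g d} \<longrightarrow>
        S (\<pi> (?g a)) (\<pi> (?g b)) (\<pi> (?g c)) (\<pi> (?g d)) = - 1) \<longleftrightarrow>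
      W \<in> snd (tournament_hypergraph Tstar)"
    if "W = {a, b, c, d}" "distinct [a, b, c, d]" for a b c d
    unfolding quadruple[OF that] tournament
    by (rule cyc4_iff_cone_triangle[OF skew sgn that arc])
  show ?thesis
  proof
    assume "?g ` W \<in> snd hypergraph_Hq"
    then show "W \<in> snd (tournament_hypergraph Tstar)"
      unfolding Hq using cone by blast
  next
    assume W_edge: "W \<in> snd (tournament_hypergraph Tstar)"
    then obtain a b c d where "W = {a, b, c, d}" "distinct [a, b, c, d]"
      unfolding tournament by blast
    with W_edge show "?g ` W \<in> snd hypergraph_Hq"
      unfolding Hq using cone by blast
  qed
qed

theorem theorem5p3:
  fixes q :: nat
  assumes "primepow q" and "q mod 4 = 3" and "card (UNIV :: 'a::{field, finite} set) = q"
  shows "\<exists>f :: 'a proj_line \<Rightarrow> 'a \<times> 'a.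
           (\<forall>x. f (proj_pt x 1) = (x, 1)) \<and> f (proj_pt 1 0) = (1, 0) \<and>
           hypergraph_iso f hypergraph_Hq (tournament_hypergraph Tstar)"
proof -
  \<comment> \<open>The inverse of normalisation, so the prescribed values are the normalised
    vectors themselves.\<close>
  let ?f = "inv_into Tstar_verts abs_proj_line :: 'a proj_line \<Rightarrow> 'a \<times> 'a"
  note bij = abs_proj_line_Tstar_verts[where 'a = 'a]
  have card: "CARD('a) mod 4 = 3"
    using assms by simp
  have f_abs: "?f (abs_proj_line u) = u" if "u \<in> Tstar_verts" for u
    using bij_betw_inv_into_left[OF bij that] .
  have vert: "(x, 1) \<in> Tstar_verts" "(1, 0) \<in> Tstar_verts" for x :: 'a
    by (auto simp: Tstar_verts_def)
  have bij_f: "bij_betw ?f UNIV Tstar_verts"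
    by (rule bij_betw_inv_into[OF bij])
  have "e \<in> snd hypergraph_Hq \<longleftrightarrow> ?f ` e \<in> snd (tournament_hypergraph Tstar)" for e
  proof -
    have "?f ` e \<subseteq> Tstar_verts"
      using bij_betw_imp_surj_on[OF bij_f] by blast
    \<comment> \<open>Every set of projective points is the image of a set of vertices, so
      \<open>hyperedge_Hq_iff\<close> applies to each \<open>e\<close>.\<close>
    moreover have "abs_proj_line ` ?f ` e = e"
      using bij_betw_inv_into_right[OF bij] by (simp add: image_image)
    ultimately show ?thesis
      using hyperedge_Hq_iff[OF card, of "?f ` e"] by simp
  qed
  then have "hypergraph_iso ?f hypergraph_Hq (tournament_hypergraph Tstar)"
    using bij_f
    by (simp add: hypergraph_iso_def hypergraph_Hq_def tournament_hypergraph_def Tstar_def)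
  moreover have "\<forall>x. ?f (proj_pt x 1) = (x, 1)" "?f (proj_pt 1 0) = (1, 0)"
    unfolding proj_pt_def by (simp_all add: f_abs vert)
  ultimately show ?thesis by blast
qed

end
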